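(* The tableau calculus $\mathbf{TAB}_{\mathbf{I4}}$ has the termination property; that is, for every formula $\varphi$ and every nominal $i$ not occurring in $\varphi$, every tableau in $\mathbf{TAB}_{\mathbf{I4}}$ with root formula $@_i\varphi$ is finite.
   Context: **Formulas.** Let $\mathbf{Prop}$ (propositional variables) and $\mathbf{Nom}$ (nominals) be disjoint countably infinite sets. Formulas are $\varphi ::= p \mid i \mid \neg\varphi \mid \varphi\land\varphi \mid \varphi\lor\varphi \mid \Diamond\varphi \mid \Box\varphi \mid @_i\varphi$ with $p\in\mathbf{Prop}$, $i\in\mathbf{Nom}$. All formulas are taken in negation normal form (NNF: negation only in front of propositional variables and nominals; $\neg @_i\varphi$ is rewritten as $@_i\neg\varphi$, Boolean and modal operators as usual), and $\neg\varphi$ denotes the NNF of the negation of $\varphi$. **Tableaus.** A tableau is a tree of formulas, built downwards from a root formula $@_i\varphi$, where $i\in\mathbf{Nom}$ does not occur in $\varphi$, by extending branches with the rules below (branches may a priori be infinite). We write $\varphi\in\Theta$ if $\varphi$ occurs in the branch $\Theta$. A branch $\Theta$ is closed if $@_i\varphi, @_i\neg\varphi\in\Theta$ for some $\varphi$, $i$; otherwise it is open. A closed branch is not extended, nor is a branch on which every formula that could be generated by applying a rule already exists; rules are not applied redundantly: each application must add a formula not already on the branch to every branch it produces. **Rules of $\mathbf{TAB}_{\mathbf{I4}}$** (premises are on the branch; conclusions are added to it): - $[Eq]$: add $@_i i$, for any nominal $i$ already occurring in the branch. - $[\land]$: from $@_i(\varphi\land\psi)$ add $@_i\varphi$ and $@_i\psi$.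 - $[\lor]$: from $@_i(\varphi\lor\psi)$ split the branch, adding $@_i\varphi$ on one side and $@_i\psi$ on the other. - $[\Diamond]$: from $@_i\Diamond\varphi$ which is not an accessibility formula, add $@_i\Diamond j$ and $@_j\varphi$, where $j$ is a nominal not occurring in the branch; it is applied at most once per formula. The formula $@_i\Diamond j$ so produced is called an accessibility formula. - $[\Box]$: from $@_i\Box\varphi$ and $@_i\Diamond j$ add $@_j\varphi$. - $[@]$: from $@_i@_j\varphi$ add $@_j\varphi$. - $[Id]$: from $@_i\varphi$, not an accessibility formula, and $@_i j$ add $@_j\varphi$. - $[Irr]$: add $@_i\Box\neg i$, for any nominal $i$ already occurring in the branch. - $[Trs]$: from $@_i\Box\varphi$ and $@_i\Diamond j$ add $@_j\Box\varphi$. - Restriction $(\mathcal D)$: $[\Diamond]$ can be applied to $@_i\Diamond\varphi$ on a branch $\Theta$ only if $i$ is a quasi-urfather on $\Theta$ (at the moment of application). **Quasi-urfathers.** $@_i\varphi$ is a prefixed subformula of $@_j\psi$ if $\varphi$ is a subformula of $\psi$. For a nominal $i$ occurring in $\Theta$, $T^\Theta(i)=T_1^\Theta(i)\cup T_2^\Theta(i)$, where $T_1^\Theta(i)$ is the set of $\varphi$ such that $@_i\varphi\in\Theta$ is a prefixed subformula of the root formula of $\Theta$, and $T_2^\Theta(i)$ is the set of $\psi$ such that $@_i\psi\in\Theta$ is a prefixed subformula of $@_j\Box\neg j$ for some $j$ occurring in the root formula. Nominals $i,j$ are twins in $\Theta$ if $T^\Theta(i)=T^\Theta(j)$. Write $i\prec_\Theta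 j$ if $j$ is introduced in $\Theta$ by applying $[\Diamond]$ to some $@_i\Diamond\varphi$; $\prec_\Theta^*$ is the reflexive transitive closure. A nominal $i$ is a quasi-urfather on $\Theta$ if there are no twins $j\neq k$ with $j\prec_\Theta^* i$ and $k\prec_\Theta^* i$. *)

theory Defs
  imports Main "HOL-Library.Sublist"
begin

type_synonym nom = nat

datatype fm =
    Pro nat
  | Nom nom
  | Neg fm
  | Con fm fm
  | Dis fm fm
  | Dia fm
  | Box fm
  | At nom fm

fun nnf :: "fm \<Rightarrow> fm" where
  "nnf (Pro p) = Pro p"
| "nnf (Nom i) = Nom i"
| "nnf (Con \<phi> \<psi>) = Con (nnf \<phi>) (nnf \<psi>)"
| "nnf (Dis \<phi> \<psi>) = Dis (nnf \<phi>) (nnf \<psi>)"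
| "nnf (Dia \<phi>) = Dia (nnf \<phi>)"
| "nnf (Box \<phi>) = Box (nnf \<phi>)"
| "nnf (At i \<phi>) = At i (nnf \<phi>)"
| "nnf (Neg (Pro p)) = Neg (Pro p)"
| "nnf (Neg (Nom i)) = Neg (Nom i)"
| "nnf (Neg (Neg \<phi>)) = nnf \<phi>"
| "nnf (Neg (Con \<phi> \<psi>)) = Dis (nnf (Neg \<phi>)) (nnf (Neg \<psi>))"
| "nnf (Neg (Dis \<phi> \<psi>)) = Con (nnf (Neg \<phi>)) (nnf (Neg \<psi>))"
| "nnf (Neg (Dia \<phi>)) = Box (nnf (Neg \<phi>))"
| "nnf (Neg (Box \<phi>)) = Dia (nnf (Neg \<phi>))"
| "nnf (Neg (At i \<phi>)) = At i (nnf (Neg \<phi>))"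

fun noms :: "fm \<Rightarrow> nom set" where
  "noms (Pro p) = {}"
| "noms (Nom i) = {i}"
| "noms (Neg \<phi>) = noms \<phi>"
| "noms (Con \<phi> \<psi>) = noms \<phi> \<union> noms \<psi>"
| "noms (Dis \<phi> \<psi>) = noms \<phi> \<union> noms \<psi>"
| "noms (Dia \<phi>) = noms \<phi>"
| "noms (Box \<phi>) = noms \<phi>"
| "noms (At i \<phi>) = insert i (noms \<phi>)"

fun subfms :: "fm \<Rightarrow> fm set" where
  "subfms (Pro p) = {Pro p}"
| "subfms (Nom i) = {Nom i}"
| "subfms (Neg \<phi>) = insert (Neg \<phi>) (subfms \<phi>)"
| "subfms (Con \<phi> \<psi>) = insert (Con \<phi> \<psi>) (subfms \<phi> \<union> subfms \<psi>)"
| "subfms (Dis \<phi> \<psi>) = insert (Dis \<phi> \<psi>) (subfms \<phi> \<union> subfms \<psi>)"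
| "subfms (Dia \<phi>) = insert (Dia \<phi>) (subfms \<phi>)"
| "subfms (Box \<phi>) = insert (Box \<phi>) (subfms \<phi>)"
| "subfms (At i \<phi>) = insert (At i \<phi>) (subfms \<phi>)"

definition prefixed_subfm :: "fm \<Rightarrow> fm \<Rightarrow> bool" where
  "prefixed_subfm \<chi> \<rho> \<longleftrightarrow>
     (\<exists>i \<phi> j \<psi>. \<chi> = At i \<phi> \<and> \<rho> = At j \<psi> \<and> \<phi> \<in> subfms \<psi>)"

text \<open>
  An entry is the block of formulas that one rule application adds to one branch.
  \<open>Witness i \<phi> j\<close> records an application of the diamond rule to \<open>At i (Dia \<phi>)\<close> with
  the new nominal \<open>j\<close>. These applications are recorded because accessibility formulas, the
  relation \<open>prec\<close> and the requirement that the rule is applied at most once per formula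
  depend on how a formula was produced and not only on its shape.
  A (finite) branch is the list of its entries, the first one holding just the root formula.
\<close>

datatype entry = Added "fm list" | Witness nom fm nom

type_synonym branch = "entry list"

fun entry_fms :: "entry \<Rightarrow> fm list" where
  "entry_fms (Added \<chi>s) = \<chi>s"
| "entry_fms (Witness i \<phi> j) = [At i (Dia (Nom j)), At j \<phi>]"

definition fms :: "branch \<Rightarrow> fm list" where
  "fms \<Theta> = concat (map entry_fms \<Theta>)"

definition occurs :: "fm \<Rightarrow> branch \<Rightarrow> bool" (infix "on" 50) where
  "\<chi> on \<Theta> \<longleftrightarrow> \<chi> \<in> set (fms \<Theta>)"

definition root_fm :: "branch \<Rightarrow> fm" where
  "root_fm \<Theta> = hd (fms \<Theta>)"

definition branch_noms :: "branch \<Rightarrow> nom set" where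
  "branch_noms \<Theta> = (\<Union>\<chi>\<in>set (fms \<Theta>). noms \<chi>)"

definition closed_branch :: "branch \<Rightarrow> bool" where
  "closed_branch \<Theta> \<longleftrightarrow> (\<exists>i \<phi>. At i \<phi> on \<Theta> \<and> At i (nnf (Neg \<phi>)) on \<Theta>)"

definition prec :: "branch \<Rightarrow> (nom \<times> nom) set" where
  "prec \<Theta> = {(i, j). \<exists>\<phi>. Witness i \<phi> j \<in> set \<Theta>}"

definition accessibility_fms :: "branch \<Rightarrow> fm set" where
  "accessibility_fms \<Theta> = {At i (Dia (Nom j)) | i j \<phi>. Witness i \<phi> j \<in> set \<Theta>}"

definition T1 :: "branch \<Rightarrow> nom \<Rightarrow> fm set" where
  "T1 \<Theta> i = {\<phi>. At i \<phi> on \<Theta> \<and> prefixed_subfm (At i \<phi>) (root_fm \<Theta>)}"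

definition T2 :: "branch \<Rightarrow> nom \<Rightarrow> fm set" where
  "T2 \<Theta> i = {\<psi>. At i \<psi> on \<Theta> \<and>
     (\<exists>j\<in>noms (root_fm \<Theta>). prefixed_subfm (At i \<psi>) (At j (Box (Neg (Nom j)))))}"

definition T :: "branch \<Rightarrow> nom \<Rightarrow> fm set" where
  "T \<Theta> i = T1 \<Theta> i \<union> T2 \<Theta> i"

definition twins :: "branch \<Rightarrow> nom \<Rightarrow> nom \<Rightarrow> bool" where
  "twins \<Theta> i j \<longleftrightarrow> i \<in> branch_noms \<Theta> \<and> j \<in> branch_noms \<Theta> \<and> T \<Theta> i = T \<Theta> j"

definition quasi_urfather :: "branch \<Rightarrow> nom \<Rightarrow> bool" where
  "quasi_urfather \<Theta> i \<longleftrightarrow> i \<in> branch_noms \<Theta> \<and>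
     \<not> (\<exists>j k. j \<noteq> k \<and> twins \<Theta> j k \<and> (j, i) \<in> (prec \<Theta>)\<^sup>* \<and> (k, i) \<in> (prec \<Theta>)\<^sup>*)"

text \<open>
  \<open>rule_I4 \<Theta> es\<close>: the premises of some rule hold on \<open>\<Theta>\<close>, and applying it replaces \<open>\<Theta>\<close> by
  the branches \<open>\<Theta> @ [e]\<close> for the members \<open>e\<close> of \<open>es\<close>.
\<close>

inductive rule_I4 :: "branch \<Rightarrow> entry list \<Rightarrow> bool" for \<Theta> :: branch where
  Eq: "i \<in> branch_noms \<Theta> \<Longrightarrow> rule_I4 \<Theta> [Added [At i (Nom i)]]"
| Con: "At i (Con \<phi> \<psi>) on \<Theta> \<Longrightarrow> rule_I4 \<Theta> [Added [At i \<phi>, At i \<psi>]]"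
| Dis: "At i (Dis \<phi> \<psi>) on \<Theta> \<Longrightarrow> rule_I4 \<Theta> [Added [At i \<phi>], Added [At i \<psi>]]"
| Dia: "\<lbrakk> At i (Dia \<phi>) on \<Theta>; At i (Dia \<phi>) \<notin> accessibility_fms \<Theta>;
          j \<notin> branch_noms \<Theta>; \<forall>k. Witness i \<phi> k \<notin> set \<Theta>; quasi_urfather \<Theta> i \<rbrakk>
        \<Longrightarrow> rule_I4 \<Theta> [Witness i \<phi> j]"
| Box: "\<lbrakk> At i (Box \<phi>) on \<Theta>; At i (Dia (Nom j)) on \<Theta> \<rbrakk> \<Longrightarrow> rule_I4 \<Theta> [Added [At j \<phi>]]"
| At: "At i (At j \<phi>) on \<Theta> \<Longrightarrow> rule_I4 \<Theta> [Added [At j \<phi>]]"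
| Id: "\<lbrakk> At i \<phi> on \<Theta>; At i \<phi> \<notin> accessibility_fms \<Theta>; At i (Nom j) on \<Theta> \<rbrakk>
       \<Longrightarrow> rule_I4 \<Theta> [Added [At j \<phi>]]"
| Irr: "i \<in> branch_noms \<Theta> \<Longrightarrow> rule_I4 \<Theta> [Added [At i (Box (Neg (Nom i)))]]"
| Trs: "\<lbrakk> At i (Box \<phi>) on \<Theta>; At i (Dia (Nom j)) on \<Theta> \<rbrakk> \<Longrightarrow> rule_I4 \<Theta> [Added [At j (Box \<phi>)]]"

definition extension_I4 :: "branch \<Rightarrow> entry list \<Rightarrow> bool" where
  "extension_I4 \<Theta> es \<longleftrightarrow> \<not> closed_branch \<Theta> \<and> rule_I4 \<Theta> es \<and>
     (\<forall>e\<in>set es. \<exists>\<chi>\<in>set (entry_fms e). \<not> \<chi> on \<Theta>)"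

text \<open>
  A possibly infinite tree maps its nodes to their labels. A node is the list of child indices
  on the path from the root, so \<open>p @ [n]\<close> is child number \<open>n\<close> of \<open>p\<close>.
\<close>

type_synonym tree = "nat list \<rightharpoonup> entry"

definition branch_to :: "tree \<Rightarrow> nat list \<Rightarrow> branch" where
  "branch_to t p = map (\<lambda>q. the (t q)) (prefixes p)"

text \<open>
  Branches may be left unextended at any point, so unfinished tableaus are included.
\<close>

definition tableau_I4 :: "fm \<Rightarrow> tree \<Rightarrow> bool" where
  "tableau_I4 \<rho> t \<longleftrightarrow>
     t [] = Some (Added [\<rho>]) \<and>
     (\<forall>p\<in>dom t. \<forall>q. prefix q p \<longrightarrow> q \<in> dom t) \<and>
     (\<forall>p\<in>dom t. \<exists>es. (es = [] \<or> extension_I4 (branch_to t p) es) \<and>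
        (\<forall>n. t (p @ [n]) = (if n < length es then Some (es ! n) else None)))"

end

theory Submission
  imports Defs
begin

text \<open>
  Every nominal on a branch is named by a nominal of the root formula together with the list of
  the diamond formulas whose witnesses lead to it; distinct nominals have distinct names because
  the diamond rule is applied at most once per formula. When the rule is applied at \<open>i\<close>, the
  ancestors of \<open>i\<close> have pairwise distinct sets \<open>T\<close>, all contained in one finite set \<open>F\<close>
  determined by the root, so \<open>i\<close> has at most \<open>2 ^ card F\<close> ancestors. Hence the names have bounded
  length, which bounds the number of nominals on a branch, the number of formulas on it (all are
  prefixed subformulas of the root, accessibility formulas, or built from one nominal by \<open>Eq\<close>
  and \<open>Irr\<close>), and so its length. As a node has at most two children, the tableau is finite.
\<close>

section \<open>Subformulas and the nominals of a branch\<close>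

lemma subfms_refl [simp]: "\<phi> \<in> subfms \<phi>"
  by (cases \<phi>) auto

lemma subfms_trans: "\<psi> \<in> subfms \<phi> \<Longrightarrow> \<chi> \<in> subfms \<psi> \<Longrightarrow> \<chi> \<in> subfms \<phi>"
  by (induction \<phi>) auto

lemma finite_subfms [simp]: "finite (subfms \<phi>)"
  by (induction \<phi>) auto

lemma finite_noms [simp]: "finite (noms \<phi>)"
  by (induction \<phi>) auto

lemma fms_append [simp]: "set (fms (\<Theta> @ [e])) = set (fms \<Theta>) \<union> set (entry_fms e)"
  by (simp add: fms_def)

lemma branch_noms_append [simp]:
  "branch_noms (\<Theta> @ [e]) = branch_noms \<Theta> \<union> (\<Union>\<chi>\<in>set (entry_fms e). noms \<chi>)"
  by (simp add: branch_noms_def)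

lemma finite_branch_noms [simp]: "finite (branch_noms \<Theta>)"
  by (simp add: branch_noms_def)

lemma noms_on_branch: "\<chi> on \<Theta> \<Longrightarrow> noms \<chi> \<subseteq> branch_noms \<Theta>"
  by (auto simp: occurs_def branch_noms_def)

lemma Witness_noms:
  assumes "Witness i \<phi> j \<in> set \<Theta>"
  shows "i \<in> branch_noms \<Theta>" "j \<in> branch_noms \<Theta>"
proof -
  have "At i (Dia (Nom j)) on \<Theta>"
    using assms by (force simp: occurs_def fms_def)
  then show "i \<in> branch_noms \<Theta>" "j \<in> branch_noms \<Theta>"
    using noms_on_branch by fastforce+
qed

section \<open>Ancestors of a nominal and their number at quasi-urfathers\<close>

definition ancestors :: "branch \<Rightarrow> nom \<Rightarrow> nom set" where
  "ancestors \<Theta> i = {k. (k, i) \<in> (prec \<Theta>)\<^sup>*}"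

lemma ancestors_subset: "ancestors \<Theta> i \<subseteq> insert i (branch_noms \<Theta>)"
proof
  fix k
  assume "k \<in> ancestors \<Theta> i"
  then have "(k, i) \<in> (prec \<Theta>)\<^sup>*"
    by (simp add: ancestors_def)
  then show "k \<in> insert i (branch_noms \<Theta>)"
    by (cases rule: converse_rtranclE) (auto simp: prec_def dest: Witness_noms)
qed

lemma finite_ancestors [simp]: "finite (ancestors \<Theta> i)"
  using ancestors_subset by (rule finite_subset) simp

lemma ancestors_append: "ancestors \<Theta> i \<subseteq> ancestors (\<Theta> @ [e]) i"
proof -
  have "(prec \<Theta>)\<^sup>* \<subseteq> (prec (\<Theta> @ [e]))\<^sup>*"
    by (rule rtrancl_mono) (auto simp: prec_def)
  then show ?thesis
    by (auto simp: ancestors_def)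
qed

text \<open>When \<open>j\<close> is fresh, this makes the ancestor count grow by at least one along
  each witness edge.\<close>

lemma ancestors_Witness:
  "insert j (ancestors \<Theta> i) \<subseteq> ancestors (\<Theta> @ [Witness i \<phi> j]) j"
proof -
  have "(i, j) \<in> prec (\<Theta> @ [Witness i \<phi> j])"
    by (auto simp: prec_def)
  then show ?thesis
    using ancestors_append[of \<Theta> i "Witness i \<phi> j"]
    by (auto simp: ancestors_def intro: rtrancl_into_rtrancl)
qed

text \<open>This is the set \<open>F\<close> of the overview: the first part bounds
  \<open>T1\<close>, the second \<open>T2\<close>.\<close>

definition twin_fms :: "fm \<Rightarrow> fm set" where
  "twin_fms \<rho> = {\<psi>. \<exists>j \<phi>. \<rho> = At j \<phi> \<and> \<psi> \<in> subfms \<phi>} \<union>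
     (\<Union>j\<in>noms \<rho>. subfms (Box (Neg (Nom j))))"

lemma finite_twin_fms [simp]: "finite (twin_fms \<rho>)"
proof -
  have "finite {\<psi>. \<exists>j \<phi>. \<rho> = At j \<phi> \<and> \<psi> \<in> subfms \<phi>}"
    by (cases \<rho>) auto
  then show ?thesis
    by (simp add: twin_fms_def)
qed

lemma T_subset: "T \<Theta> i \<subseteq> twin_fms (root_fm \<Theta>)"
  by (auto simp: T_def T1_def T2_def twin_fms_def prefixed_subfm_def)

lemma card_ancestors_quasi_urfather:
  assumes "quasi_urfather \<Theta> i"
  shows "card (ancestors \<Theta> i) \<le> 2 ^ card (twin_fms (root_fm \<Theta>))"
proof -
  \<comment> \<open>\<open>twins\<close> only relates nominals of the branch, so distinct ancestors
    with equal \<open>T\<close> contradict the quasi-urfather condition only once they are known to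
    occur.\<close>
  have "ancestors \<Theta> i \<subseteq> branch_noms \<Theta>"
    using assms ancestors_subset[of \<Theta> i] by (auto simp: quasi_urfather_def)
  then have "inj_on (T \<Theta>) (ancestors \<Theta> i)"
    using assms by (force simp: inj_on_def quasi_urfather_def twins_def ancestors_def)
  then have "card (ancestors \<Theta> i) \<le> card (Pow (twin_fms (root_fm \<Theta>)))"
    using T_subset by (intro card_inj_on_le[of "T \<Theta>"]) auto
  then show ?thesis
    by (simp add: card_Pow)
qed

section \<open>Naming nominals by paths of witnesses\<close>

fun witness_path :: "branch \<Rightarrow> nom \<Rightarrow> fm list \<Rightarrow> nom \<Rightarrow> bool" where
  "witness_path \<Theta> r [] j \<longleftrightarrow> j = r"
| "witness_path \<Theta> r (\<phi> # \<phi>s) j \<longleftrightarrow> (\<exists>i. witness_path \<Theta> r \<phi>s i \<and> Witness i \<phi> j \<in> set \<Theta>)"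

lemma witness_path_append: "witness_path \<Theta> r \<phi>s j \<Longrightarrow> witness_path (\<Theta> @ [e]) r \<phi>s j"
  by (induction \<phi>s arbitrary: j) auto

definition unique_witnesses :: "branch \<Rightarrow> bool" where
  "unique_witnesses \<Theta> \<longleftrightarrow>
     (\<forall>i \<phi> j k. Witness i \<phi> j \<in> set \<Theta> \<longrightarrow> Witness i \<phi> k \<in> set \<Theta> \<longrightarrow> j = k)"

text \<open>The head of a path is its last witness step. Inductively the tail fixes the parent,
  which has at most one witness for that formula.\<close>

lemma witness_path_unique:
  assumes "unique_witnesses \<Theta>" "witness_path \<Theta> r \<phi>s j" "witness_path \<Theta> r \<phi>s k"
  shows "j = k"
  using assms(2,3)
proof (induction \<phi>s arbitrary: j k)
  case (Cons \<phi> \<phi>s)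
  then show ?case
    using assms(1) unfolding unique_witnesses_def by (metis witness_path.simps(2))
qed simp

section \<open>Shape of the formulas on a branch\<close>

inductive plain :: "fm \<Rightarrow> fm \<Rightarrow> bool" for \<xi> where
  subfm: "\<psi> \<in> subfms \<xi> \<Longrightarrow> plain \<xi> (At i \<psi>)"
| Nom: "plain \<xi> (At i (Nom k))"
| Neg_Nom: "plain \<xi> (At i (Neg (Nom k)))"
| Box_Neg_Nom: "plain \<xi> (At i (Box (Neg (Nom k))))"

inductive_simps plain_At: "plain \<xi> (At i \<psi>)"

inductive branch_I4 :: "fm \<Rightarrow> branch \<Rightarrow> bool" for \<rho> where
  root: "branch_I4 \<rho> [Added [\<rho>]]"
| extend: "branch_I4 \<rho> \<Theta> \<Longrightarrow> extension_I4 \<Theta> es \<Longrightarrow> e \<in> set es \<Longrightarrow> branch_I4 \<rho> (\<Theta> @ [e])"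

lemma root_fm_branch:
  assumes "branch_I4 \<rho> \<Theta>"
  shows "root_fm \<Theta> = \<rho>"
proof -
  from assms have "\<exists>\<Theta>'. \<Theta> = Added [\<rho>] # \<Theta>'"
    by induction auto
  then show ?thesis
    by (auto simp: root_fm_def fms_def)
qed

text \<open>The shape invariant is assumed for the old branch only, so that this analysis can serve
  as the induction step in proving it.\<close>

lemma rule_entry_cases:
  assumes "rule_I4 \<Theta> es" "e \<in> set es"
    and inv: "\<And>\<chi>. \<chi> on \<Theta> \<Longrightarrow> plain \<xi> \<chi> \<or> \<chi> \<in> accessibility_fms \<Theta>"
  obtains (Added) \<chi>s where "e = Added \<chi>s" "\<And>\<chi>. \<chi> \<in> set \<chi>s \<Longrightarrow> noms \<chi> \<subseteq> branch_noms \<Theta>"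
      "\<And>\<chi>. \<chi> \<in> set \<chi>s \<Longrightarrow> plain \<xi> \<chi>"
  | (Witness) i \<phi> j where "e = Witness i \<phi> j" "\<phi> \<in> subfms \<xi>" "At i (Dia \<phi>) on \<Theta>"
      "j \<notin> branch_noms \<Theta>" "\<And>k. Witness i \<phi> k \<notin> set \<Theta>" "quasi_urfather \<Theta> i"
  using assms(1)
proof cases
  case (Eq i)
  then show thesis
    using assms(2) by (intro Added) (auto intro: plain.intros)
next
  case (Con i \<phi> \<psi>)
  then have "Con \<phi> \<psi> \<in> subfms \<xi>"
    using inv by (fastforce simp: plain_At accessibility_fms_def)
  then have "\<phi> \<in> subfms \<xi>" "\<psi> \<in> subfms \<xi>"
    by (auto intro: subfms_trans)
  then show thesis
    using assms(2) Con noms_on_branch[OF Con(2)]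
    by (intro Added[of "[At i \<phi>, At i \<psi>]"]) (auto intro: plain.intros)
next
  case (Dis i \<phi> \<psi>)
  then have "Dis \<phi> \<psi> \<in> subfms \<xi>"
    using inv by (fastforce simp: plain_At accessibility_fms_def)
  then have "\<phi> \<in> subfms \<xi>" "\<psi> \<in> subfms \<xi>"
    by (auto intro: subfms_trans)
  then obtain \<chi> where "e = Added [\<chi>]" "noms \<chi> \<subseteq> branch_noms \<Theta>" "plain \<xi> \<chi>"
    using assms(2) Dis noms_on_branch[OF Dis(2)] by (auto simp: plain_At)
  then show thesis
    by (intro Added) auto
next
  case (Dia i \<phi> j)
  \<comment> \<open>The side condition excludes accessibility formulas, and no other shape outside
    \<open>subfms \<xi>\<close> is a diamond.\<close>
  then have "Dia \<phi> \<in> subfms \<xi>"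
    using inv by (fastforce simp: plain_At)
  then have "\<phi> \<in> subfms \<xi>"
    by (auto intro: subfms_trans)
  then show thesis
    using assms(2) Dia by (intro Witness) auto
next
  case (Box i \<phi> j)
  \<comment> \<open>The premise may also be an irreflexivity formula, whose body is a negated
    nominal.\<close>
  then have "Box \<phi> \<in> subfms \<xi> \<or> (\<exists>k. \<phi> = Neg (Nom k))"
    using inv by (fastforce simp: plain_At accessibility_fms_def)
  then have "\<phi> \<in> subfms \<xi> \<or> (\<exists>k. \<phi> = Neg (Nom k))"
    by (auto intro: subfms_trans)
  then show thesis
    using assms(2) Box noms_on_branch[OF Box(2)] noms_on_branch[OF Box(3)]
    by (intro Added) (auto intro: plain.intros)
next
  case (At i j \<phi>)
  then have "At j \<phi> \<in> subfms \<xi>"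
    using inv by (fastforce simp: plain_At accessibility_fms_def)
  then have "\<phi> \<in> subfms \<xi>"
    by (auto intro: subfms_trans)
  then show thesis
    using assms(2) At noms_on_branch[OF At(2)] by (intro Added) (auto intro: plain.intros)
next
  case (Id i \<phi> j)
  then have "plain \<xi> (At j \<phi>)"
    using inv[OF Id(2)] by (auto simp: plain_At)
  then show thesis
    using assms(2) Id noms_on_branch[OF Id(2)] noms_on_branch[OF Id(4)]
    by (intro Added) auto
next
  case (Irr i)
  then show thesis
    using assms(2) by (intro Added) (auto intro: plain.intros)
next
  case (Trs i \<phi> j)
  then have "plain \<xi> (At j (Box \<phi>))"
    using inv[OF Trs(2)] by (auto simp: plain_At accessibility_fms_def)
  then show thesis
    using assms(2) Trs noms_on_branch[OF Trs(2)] noms_on_branch[OF Trs(3)]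
    by (intro Added) auto
qed

text \<open>Beyond subformulas of \<open>\<xi>\<close>, \<open>Eq\<close> creates nominals,
  \<open>Irr\<close> boxed negated nominals, and \<open>Box\<close> strips the latter.
  \<open>Id\<close> and \<open>Trs\<close> only change the prefix, which \<open>plain\<close> leaves
  free.\<close>

lemma branch_formula_shape:
  assumes "branch_I4 (At r \<xi>) \<Theta>" "\<chi> on \<Theta>"
  shows "plain \<xi> \<chi> \<or> \<chi> \<in> accessibility_fms \<Theta>"
  using assms
proof (induction arbitrary: \<chi>)
  case root
  then show ?case
    by (auto simp: occurs_def fms_def intro: plain.intros)
next
  case (extend \<Theta> es e)
  have "rule_I4 \<Theta> es"
    using extend.hyps by (simp add: extension_I4_def)
  then have "\<forall>\<chi>\<in>set (entry_fms e). plain \<xi> \<chi> \<or> \<chi> \<in> accessibility_fms (\<Theta> @ [e])"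
    using \<open>e \<in> set es\<close> extend.IH
    by (cases rule: rule_entry_cases[where \<xi> = \<xi>])
      (auto simp: accessibility_fms_def intro: plain.intros)
  moreover have "accessibility_fms \<Theta> \<subseteq> accessibility_fms (\<Theta> @ [e])"
    by (auto simp: accessibility_fms_def)
  ultimately show ?case
    using extend.prems extend.IH by (auto simp: occurs_def)
qed

lemma branch_extend_cases:
  assumes "branch_I4 (At r \<xi>) \<Theta>" "extension_I4 \<Theta> es" "e \<in> set es"
  obtains (Added) \<chi>s where "e = Added \<chi>s" "\<And>\<chi>. \<chi> \<in> set \<chi>s \<Longrightarrow> noms \<chi> \<subseteq> branch_noms \<Theta>"
  | (Witness) i \<phi> j where "e = Witness i \<phi> j" "\<phi> \<in> subfms \<xi>" "At i (Dia \<phi>) on \<Theta>"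
      "j \<notin> branch_noms \<Theta>" "\<And>k. Witness i \<phi> k \<notin> set \<Theta>" "quasi_urfather \<Theta> i"
proof -
  have "rule_I4 \<Theta> es"
    using assms(2) by (simp add: extension_I4_def)
  from this assms(3) branch_formula_shape[OF assms(1)] show thesis
    by (cases rule: rule_entry_cases[where \<xi> = \<xi>]) (use that in blast)+
qed

section \<open>Bounding the nominals of a branch\<close>

lemma branch_unique_witnesses:
  assumes "branch_I4 (At r \<xi>) \<Theta>"
  shows "unique_witnesses \<Theta>"
  using assms
proof induction
  case root
  then show ?case
    by (simp add: unique_witnesses_def)
next
  case (extend \<Theta> es e)
  from extend.hyps show ?case
    by (cases rule: branch_extend_cases) (use extend.IH in \<open>auto simp: unique_witnesses_def\<close>)
qed

definition path_codes :: "fm \<Rightarrow> (nom \<times> fm list) set" where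
  "path_codes \<rho> = noms \<rho> \<times>
     {\<phi>s. set \<phi>s \<subseteq> subfms \<rho> \<and> length \<phi>s \<le> 2 ^ card (twin_fms \<rho>)}"

lemma finite_path_codes [simp]: "finite (path_codes \<rho>)"
  by (simp add: path_codes_def finite_lists_length_le)

text \<open>The strict comparison with the ancestor count is what carries the induction: at a
  quasi-urfather it turns into the length bound of \<open>path_codes\<close> with room for one more
  formula.\<close>

lemma branch_nom_path:
  assumes "branch_I4 (At r \<xi>) \<Theta>" "j \<in> branch_noms \<Theta>"
  shows "\<exists>(k, \<phi>s)\<in>path_codes (At r \<xi>). witness_path \<Theta> k \<phi>s j \<and> length \<phi>s < card (ancestors \<Theta> j)"
  using assms
proof (induction arbitrary: j)
  case root
  then have "j \<in> noms (At r \<xi>)"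
    by (simp add: branch_noms_def fms_def)
  moreover have "j \<in> ancestors \<Theta>' j" for \<Theta>'
    by (simp add: ancestors_def)
  then have "0 < card (ancestors \<Theta>' j)" for \<Theta>'
    by (auto simp: card_gt_0_iff)
  ultimately show ?case
    by (intro bexI[of _ "(j, [])"]) (auto simp: path_codes_def)
next
  case (extend \<Theta> es e)
  \<comment> \<open>Extending the branch preserves paths and can only enlarge ancestor sets.\<close>
  have old: ?case if j: "j \<in> branch_noms \<Theta>"
  proof -
    have "card (ancestors \<Theta> j) \<le> card (ancestors (\<Theta> @ [e]) j)"
      by (simp add: card_mono ancestors_append)
    then show ?thesis
      using extend.IH[OF j] by (force intro: witness_path_append)
  qed
  from extend.hyps show ?case
  proof (cases rule: branch_extend_cases)
    case (Added \<chi>s)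
    then show ?thesis
      using extend.prems old by auto
  next
    case (Witness i \<phi> j')
    note noms_on_branch[OF Witness(3)]
    then have i: "i \<in> branch_noms \<Theta>" and "noms \<phi> \<subseteq> branch_noms \<Theta>"
      by auto
    then consider "j \<in> branch_noms \<Theta>" | "j = j'"
      using extend.prems Witness(1) by auto
    then show ?thesis
    proof cases
      case 2
      obtain k \<phi>s where code: "(k, \<phi>s) \<in> path_codes (At r \<xi>)" and
        path: "witness_path \<Theta> k \<phi>s i" and len: "length \<phi>s < card (ancestors \<Theta> i)"
        using extend.IH[OF i] by auto
      have "length \<phi>s < 2 ^ card (twin_fms (At r \<xi>))"
        using len card_ancestors_quasi_urfather[OF Witness(6)] root_fm_branch[OF extend.hyps(1)]
        by simp
      then have "(k, \<phi> # \<phi>s) \<in> path_codes (At r \<xi>)"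
        using code Witness(2) by (auto simp: path_codes_def)
      moreover have "witness_path (\<Theta> @ [e]) k (\<phi> # \<phi>s) j"
        using 2 Witness(1) witness_path_append[OF path] by auto
      \<comment> \<open>All ancestors of \<open>i\<close> occur on \<open>\<Theta>\<close>, whereas
        \<open>j'\<close> is fresh; so the child has at least one ancestor more, matching the longer
        path.\<close>
      moreover have "j' \<notin> ancestors \<Theta> i"
        using ancestors_subset[of \<Theta> i] i Witness(4) by auto
      then have "Suc (card (ancestors \<Theta> i)) \<le> card (ancestors (\<Theta> @ [e]) j)"
        using 2 Witness(1) card_mono[OF _ ancestors_Witness[of j' \<Theta> i \<phi>]] by simp
      ultimately show ?thesis
        using len by (intro bexI[of _ "(k, \<phi> # \<phi>s)"]) auto
    qed (rule old)
  qed
qed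

lemma card_branch_noms:
  assumes "branch_I4 (At r \<xi>) \<Theta>"
  shows "card (branch_noms \<Theta>) \<le> card (path_codes (At r \<xi>))"
proof -
  \<comment> \<open>Decoding: \<open>THE\<close> picks the nominal at the end of the path. Codes
    without a path get an arbitrary value, harmless for covering
    \<open>branch_noms \<Theta>\<close>.\<close>
  let ?f = "\<lambda>(k, \<phi>s). THE j. witness_path \<Theta> k \<phi>s j"
  have "branch_noms \<Theta> \<subseteq> ?f ` path_codes (At r \<xi>)"
  proof
    fix j
    assume "j \<in> branch_noms \<Theta>"
    then obtain k \<phi>s where code: "(k, \<phi>s) \<in> path_codes (At r \<xi>)"
      and path: "witness_path \<Theta> k \<phi>s j"
      using branch_nom_path[OF assms, of j] by auto
    have "(THE j. witness_path \<Theta> k \<phi>s j) = j"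
      using path witness_path_unique[OF branch_unique_witnesses[OF assms]] by blast
    then show "j \<in> ?f ` path_codes (At r \<xi>)"
      using code by (intro image_eqI[of _ _ "(k, \<phi>s)"]) auto
  qed
  then show ?thesis
    by (rule surj_card_le[rotated]) simp
qed

section \<open>Bounding the formulas and the length of a branch\<close>

lemma card_branch_fms:
  assumes "branch_I4 (At r \<xi>) \<Theta>" and b: "b = card (path_codes (At r \<xi>))"
  shows "card (set (fms \<Theta>)) \<le> b * (card (subfms \<xi>) + 4 * b)"
proof -
  let ?N = "branch_noms \<Theta>"
  \<comment> \<open>The three shapes of \<open>plain\<close> built from one nominal, followed by
    that of accessibility formulas.\<close>
  let ?B = "[Nom, \<lambda>k. Neg (Nom k), \<lambda>k. Box (Neg (Nom k)), \<lambda>k. Dia (Nom k)]"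
  let ?R = "subfms \<xi> \<union> (\<Union>f\<in>set ?B. f ` ?N)"
  have N: "card ?N \<le> b"
    using card_branch_noms[OF assms(1)] b by simp
  have "set (fms \<Theta>) \<subseteq> (\<lambda>(i, \<psi>). At i \<psi>) ` (?N \<times> ?R)"
  proof
    fix \<chi>
    assume "\<chi> \<in> set (fms \<Theta>)"
    then have on: "\<chi> on \<Theta>"
      by (simp add: occurs_def)
    from branch_formula_shape[OF assms(1) on] noms_on_branch[OF on]
    show "\<chi> \<in> (\<lambda>(i, \<psi>). At i \<psi>) ` (?N \<times> ?R)"
      by (auto simp: accessibility_fms_def image_iff elim!: plain.cases)
  qed
  then have "card (set (fms \<Theta>)) \<le> card (?N \<times> ?R)"
    by (rule surj_card_le[rotated]) simp
  also have "\<dots> \<le> b * card ?R"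
    using N by (simp add: card_cartesian_product)
  also have "card ?R \<le> card (subfms \<xi>) + 4 * b"
  proof -
    have "card (f ` ?N) \<le> b" for f :: "nom \<Rightarrow> fm"
      using N card_image_le[of ?N f] by simp
    then have "(\<Sum>f\<in>set ?B. card (f ` ?N)) \<le> card (set ?B) * b"
      using sum_bounded_above[of "set ?B" "\<lambda>f. card (f ` ?N)" b] by simp
    \<comment> \<open>Bounding the cardinality by the list length avoids proving the four functions
      distinct.\<close>
    also have "\<dots> \<le> 4 * b"
      using card_length[of ?B] by (intro mult_right_mono) simp_all
    finally have "card (\<Union>f\<in>set ?B. f ` ?N) \<le> 4 * b"
      using card_UN_le[of "set ?B" "\<lambda>f. f ` ?N"] by simp
    then show ?thesis
      using card_Un_le[of "subfms \<xi>" "\<Union>f\<in>set ?B. f ` ?N"] by linarith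
  qed
  finally show ?thesis
    by simp
qed

text \<open>The root contributes one formula, and non-redundancy makes every later entry add a new
  one.\<close>

lemma branch_length_le_card_fms:
  assumes "branch_I4 \<rho> \<Theta>"
  shows "length \<Theta> \<le> card (set (fms \<Theta>))"
  using assms
proof induction
  case root
  then show ?case
    by (simp add: fms_def)
next
  case (extend \<Theta> es e)
  then have "set (fms \<Theta>) \<subset> set (fms (\<Theta> @ [e]))"
    by (auto simp: extension_I4_def occurs_def)
  then have "card (set (fms \<Theta>)) < card (set (fms (\<Theta> @ [e])))"
    by (rule psubset_card_mono[rotated]) simp
  then show ?case
    using extend.IH by simp
qed

lemma rule_I4_length: "rule_I4 \<Theta> es \<Longrightarrow> length es \<le> 2"
  by (cases rule: rule_I4.cases) auto

section \<open>From branches to the tree\<close>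

lemma tableau_branch:
  assumes t: "tableau_I4 \<rho> t" and "p \<in> dom t"
  shows "branch_I4 \<rho> (branch_to t p) \<and> set p \<subseteq> {0, 1}"
  using assms(2)
proof (induction p rule: rev_induct)
  case Nil
  then show ?case
    using t by (simp add: tableau_I4_def branch_to_def branch_I4.root)
next
  case (snoc n p)
  then have p: "p \<in> dom t"
    using t unfolding tableau_I4_def by (meson prefixI)
  then obtain es where es: "es = [] \<or> extension_I4 (branch_to t p) es"
    "\<forall>n. t (p @ [n]) = (if n < length es then Some (es ! n) else None)"
    using t unfolding tableau_I4_def by meson
  with snoc.prems have n: "n < length es" and tn: "t (p @ [n]) = Some (es ! n)"
    by (auto split: if_splits)
  then have ext: "extension_I4 (branch_to t p) es"
    using es(1) by auto
  then have "n < 2"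
    using n rule_I4_length unfolding extension_I4_def by fastforce
  moreover have "branch_to t (p @ [n]) = branch_to t p @ [es ! n]"
    using tn by (simp add: branch_to_def)
  ultimately show ?case
    using snoc.IH[OF p] ext n by (auto intro: branch_I4.extend)
qed

theorem theorem3p12:
  fixes \<phi> :: fm and i :: nom and t :: tree
  assumes "i \<notin> noms \<phi>"
    and "tableau_I4 (nnf (At i \<phi>)) t"
  shows "finite (dom t)"
proof -
  define b where "b = card (path_codes (At i (nnf \<phi>)))"
  define m where "m = b * (card (subfms (nnf \<phi>)) + 4 * b)"
  have "set p \<subseteq> {0, 1} \<and> length p \<le> m" if "p \<in> dom t" for p
  proof -
    have branch: "branch_I4 (At i (nnf \<phi>)) (branch_to t p)" and p: "set p \<subseteq> {0, 1}"
      using tableau_branch[OF assms(2) that] by simp_all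
    have "length (branch_to t p) \<le> m"
      using branch_length_le_card_fms[OF branch] card_branch_fms[OF branch b_def]
      by (simp add: m_def)
    \<comment> \<open>A branch has one entry per prefix of \<open>p\<close>, the empty one included,
      so \<open>length p\<close> is one less than its length.\<close>
    then show ?thesis
      using p by (simp add: branch_to_def)
  qed
  then have "dom t \<subseteq> {p. set p \<subseteq> {0, 1} \<and> length p \<le> m}"
    by auto
  then show ?thesis
    by (rule finite_subset) (simp add: finite_lists_length_le)
qed

end
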